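(* Let $L$ be a finite-dimensional solvable Lie algebra over a field $F$. If $F$ has characteristic $p>0$, suppose further that $L^2=[L,L]$ has nilpotency class less than $p$. Let $M, K$ be maximal subalgebras of $L$. Then $M$ is conjugate to $K$ in $L$ if and only if $M_L = K_L$.
   Context: For a subalgebra $U$ of $L$, the core $U_L$ is the largest ideal of $L$ contained in $U$. For $x\in L$, $\mathrm{ad}\,x$ is the corresponding inner derivation, $y \mapsto [y,x]$. The automorphism $\exp(\mathrm{ad}\,x)=\sum_{r\ge 0}\frac{1}{r!}(\mathrm{ad}\,x)^r$ of $L$ is considered in the following cases: if $F$ has characteristic zero, when $(\mathrm{ad}\,x)^n=0$ for some $n$; if $F$ has characteristic $p>0$, when $x\in I$ for some nilpotent ideal $I$ of $L$ of nilpotency class less than $p$ (then $(\mathrm{ad}\,x)^p=0$ and only the terms with $r<p$ are taken). The group $\mathcal{I}(L)$ of inner automorphisms of $L$ is the group generated by all such automorphisms. Subsets $U,V$ of $L$ are conjugate in $L$ if $U=\alpha(V)$ for some $\alpha\in\mathcal{I}(L)$. *)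

theory Defs
  imports
    Complex_Main
    "HOL-Algebra.Bij"
    "HOL-Algebra.Generated_Groups"
begin

text \<open>A Lie algebra over a field \<open>'f\<close> of arbitrary characteristic; the underlying vector space is
  the whole type \<open>'a\<close>.\<close>

locale lie_algebra = vector_space scale
  for scale :: "'f::field \<Rightarrow> 'a::ab_group_add \<Rightarrow> 'a" +
  fixes bracket :: "'a \<Rightarrow> 'a \<Rightarrow> 'a"
  assumes bracket_add_left: "bracket (x + y) z = bracket x z + bracket y z"
    and bracket_add_right: "bracket x (y + z) = bracket x y + bracket x z"
    and bracket_scale_left: "bracket (scale c x) y = scale c (bracket x y)"
    and bracket_scale_right: "bracket x (scale c y) = scale c (bracket x y)"
    and bracket_self: "bracket x x = 0"
    and jacobi: "bracket x (bracket y z) + bracket y (bracket z x) + bracket z (bracket x y) = 0"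
begin

definition subalgebra :: "'a set \<Rightarrow> bool" where
  "subalgebra U \<longleftrightarrow> subspace U \<and> (\<forall>x\<in>U. \<forall>y\<in>U. bracket x y \<in> U)"

definition lie_ideal :: "'a set \<Rightarrow> bool" where
  "lie_ideal I \<longleftrightarrow> subspace I \<and> (\<forall>x\<in>I. \<forall>y. bracket x y \<in> I)"

definition maximal_subalgebra :: "'a set \<Rightarrow> bool" where
  "maximal_subalgebra M \<longleftrightarrow>
     subalgebra M \<and> M \<noteq> UNIV \<and> (\<forall>U. subalgebra U \<and> M \<subseteq> U \<longrightarrow> U = M \<or> U = UNIV)"

text \<open>The order on sets is inclusion, so this is the largest ideal contained in \<open>U\<close>; it exists
  by \<open>lie_ideal_core\<close> and \<open>core_greatest\<close> below.\<close>

definition core :: "'a set \<Rightarrow> 'a set" where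
  "core U = (GREATEST I. lie_ideal I \<and> I \<subseteq> U)"

definition lie_product :: "'a set \<Rightarrow> 'a set \<Rightarrow> 'a set" where
  "lie_product U V = span {bracket u v | u v. u \<in> U \<and> v \<in> V}"

primrec derived_series :: "nat \<Rightarrow> 'a set" where
  "derived_series 0 = UNIV"
| "derived_series (Suc n) = lie_product (derived_series n) (derived_series n)"

definition solvable :: bool where
  "solvable \<longleftrightarrow> (\<exists>n. derived_series n = {0})"

text \<open>The lower central series of \<open>U\<close> regarded as a Lie algebra in its own right, indexed from 0:
  \<open>lower_central U n\<close> is usually written $U^{n+1}$.\<close>

primrec lower_central :: "'a set \<Rightarrow> nat \<Rightarrow> 'a set" where
  "lower_central U 0 = U"
| "lower_central U (Suc n) = lie_product (lower_central U n) U"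

definition nilpotent :: "'a set \<Rightarrow> bool" where
  "nilpotent U \<longleftrightarrow> (\<exists>n. lower_central U n = {0})"

text \<open>Meaningful for nilpotent \<open>U\<close> only.\<close>

definition nilpotency_class :: "'a set \<Rightarrow> nat" where
  "nilpotency_class U = (LEAST n. lower_central U n = {0})"

definition ad :: "'a \<Rightarrow> 'a \<Rightarrow> 'a" where
  "ad x y = bracket y x"

text \<open>The exponential series of \<open>ad x\<close> cut off after the terms of degree \<open>r < n\<close>. The coefficients
  are written with \<open>of_nat (fact r)\<close>, since \<open>fact r :: 'f\<close> would force characteristic zero.\<close>

definition exp_ad :: "nat \<Rightarrow> 'a \<Rightarrow> 'a \<Rightarrow> 'a" where
  "exp_ad n x = (\<lambda>y. \<Sum>r<n. scale (1 / of_nat (fact r)) ((ad x ^^ r) y))"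

text \<open>In characteristic zero any \<open>n\<close> with $(\mathrm{ad}\,x)^n = 0$ gives the full exponential
  series.\<close>

definition inner_generators :: "('a \<Rightarrow> 'a) set" where
  "inner_generators =
     {exp_ad n x | n x. CHAR('f) = 0 \<and> (\<forall>y. (ad x ^^ n) y = 0)} \<union>
     {exp_ad (CHAR('f)) x | x. CHAR('f) > 0 \<and>
        (\<exists>I. lie_ideal I \<and> nilpotent I \<and> nilpotency_class I < CHAR('f) \<and> x \<in> I)}"

text \<open>The generators are automorphisms of the Lie algebra, so the group they generate may be formed
  inside the group of all bijections of the underlying set.\<close>

definition inner_automorphisms :: "('a \<Rightarrow> 'a) set" where
  "inner_automorphisms = generate (BijGroup UNIV) inner_generators"

definition conjugate :: "'a set \<Rightarrow> 'a set \<Rightarrow> bool" where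
  "conjugate U V \<longleftrightarrow> (\<exists>\<alpha>\<in>inner_automorphisms. U = \<alpha> ` V)"

lemma bracket_zero_left: "bracket 0 y = 0"
  using bracket_add_left[of 0 0 y] by simp

lemma lie_ideal_span_Union:
  assumes "\<And>I. I \<in> \<I> \<Longrightarrow> lie_ideal I"
  shows "lie_ideal (span (\<Union>\<I>))"
  unfolding lie_ideal_def
proof (intro conjI ballI allI subspace_span)
  fix x y assume "x \<in> span (\<Union>\<I>)"
  then show "bracket x y \<in> span (\<Union>\<I>)"
  proof (induction rule: span_induct_alt)
    case base
    show ?case by (simp add: bracket_zero_left span_zero)
  next
    case (step c u v)
    then have "bracket u y \<in> span (\<Union>\<I>)"
      using assms by (auto simp: lie_ideal_def intro!: span_base)
    with step show ?case
      by (simp add: bracket_add_left bracket_scale_left span_add span_scale)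
  qed
qed

lemma core_eq_span:
  assumes "subspace U"
  shows "core U = span (\<Union>{I. lie_ideal I \<and> I \<subseteq> U})"
  unfolding core_def
proof (rule Greatest_equality)
  show "lie_ideal (span (\<Union>{I. lie_ideal I \<and> I \<subseteq> U})) \<and> span (\<Union>{I. lie_ideal I \<and> I \<subseteq> U}) \<subseteq> U"
    by (intro conjI lie_ideal_span_Union span_minimal assms) auto
next
  fix J assume "lie_ideal J \<and> J \<subseteq> U"
  then show "J \<subseteq> span (\<Union>{I. lie_ideal I \<and> I \<subseteq> U})"
    by (blast intro: span_base)
qed

lemma
  assumes "subspace U"
  shows lie_ideal_core: "lie_ideal (core U)"
    and core_subset: "core U \<subseteq> U"
    and core_greatest: "lie_ideal J \<Longrightarrow> J \<subseteq> U \<Longrightarrow> J \<subseteq> core U"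
proof -
  show "lie_ideal (core U)"
    unfolding core_eq_span[OF assms] by (rule lie_ideal_span_Union) blast
  show "core U \<subseteq> U"
    unfolding core_eq_span[OF assms] by (rule span_minimal[OF _ assms]) blast
  show "J \<subseteq> core U" if "lie_ideal J" "J \<subseteq> U"
    unfolding core_eq_span[OF assms] using that by (blast intro: span_base)
qed

end

end

theory Submission
  imports Defs "HOL-Computational_Algebra.Polynomial"
begin

text \<open>
  Inner automorphisms map every ideal onto itself, so conjugate subalgebras contain the same ideals
  and have the same core (\<open>core_eq_if_conjugate\<close>). The converse rests on one structural fact: if
  \<open>W / W'\<close> is a chief factor of \<open>L\<close>, then \<open>[L\<^sup>2, W] \<subseteq> W'\<close>. When \<open>L\<^sup>2\<close> is nilpotent this holds because
  \<open>W = [W, L\<^sup>2] + W'\<close> could be iterated down the lower central series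
  (\<open>derived_algebra_centralizes_if_nilpotent\<close>). In characteristic zero it is a form of Lie's theorem,
  obtained here over an arbitrary field from Jacobson's lemma: a commutator \<open>c = [x, a]\<close> of
  endomorphisms that commutes with \<open>a\<close> is nilpotent (\<open>commutator_nilpotent_mod\<close>,
  \<open>derived_algebra_centralizes_char0\<close>).

  Now let \<open>M\<close> and \<open>K\<close> be distinct with common core \<open>C\<close>, and let \<open>A / C\<close> be a chief factor. It is
  abelian, and \<open>L / C\<close> is the semidirect product of \<open>A / C\<close> with \<open>M / C\<close> and likewise with \<open>K / C\<close>.
  The centraliser of \<open>A / C\<close> in \<open>M\<close> is an ideal of \<open>L\<close>, hence equal to \<open>C\<close>; as it contains \<open>[M, M]\<close>,
  the algebra \<open>M / C\<close> is abelian. Consequently each \<open>b \<in> M\<close> outside \<open>C\<close> acts on \<open>A / C\<close> by an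
  operator that commutes with the irreducible action of \<open>L\<close> and is therefore invertible, as in
  Schur's lemma (\<open>bracket_invertible_on_chief_factor\<close>).

  Write \<open>b = k + d\<close> with \<open>k \<in> K\<close> and \<open>d \<in> A\<close>, and solve \<open>[b, x] = - d\<close> modulo \<open>C\<close> with \<open>x \<in> A \<inter> L\<^sup>2\<close>.
  Modulo \<open>C\<close>, the exponential of \<open>ad x\<close> is \<open>y \<mapsto> y + [y, x]\<close>, which takes \<open>b\<close> to \<open>k\<close>. It takes the
  elements of \<open>M\<close> to elements commuting with \<open>k\<close> modulo \<open>C\<close>, and since \<open>k\<close> has no kernel on
  \<open>A / C\<close> these lie in \<open>K\<close> (\<open>conjugate_if_core_eq\<close>). The exponential is an admissible generator
  because \<open>x \<in> L\<^sup>2\<close>: in characteristic zero \<open>ad x\<close> lowers every chief series and so is nilpotent, and in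
  characteristic \<open>p\<close> the ideal \<open>L\<^sup>2\<close> has class less than \<open>p\<close>.
\<close>

section \<open>Brackets and ideals\<close>

context lie_algebra
begin

lemma bracket_zero_right [simp]: "bracket x 0 = 0"
  using bracket_add_right[of x 0 0] by simp

declare bracket_zero_left [simp]

lemma bracket_minus_left: "bracket (- x) y = - bracket x y"
  using bracket_add_left[of x "- x" y] by (simp add: eq_neg_iff_add_eq_0 add.commute)

lemma bracket_minus_right: "bracket x (- y) = - bracket x y"
  using bracket_add_right[of x y "- y"] by (simp add: eq_neg_iff_add_eq_0 add.commute)

lemma bracket_diff_left: "bracket (x - y) z = bracket x z - bracket y z"
  using bracket_add_left[of x "- y" z] by (simp add: bracket_minus_left)

lemma bracket_diff_right: "bracket x (y - z) = bracket x y - bracket x z"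
  using bracket_add_right[of x y "- z"] by (simp add: bracket_minus_right)

lemma bracket_skew: "bracket x y = - bracket y x"
proof -
  have "bracket (x + y) (x + y) = bracket x y + bracket y x"
    unfolding bracket_add_left bracket_add_right by (simp add: bracket_self add.commute)
  then show ?thesis by (simp add: bracket_self eq_neg_iff_add_eq_0)
qed

lemma bracket_bracket_left: "bracket (bracket x y) z = bracket x (bracket y z) - bracket y (bracket x z)"
proof -
  have "bracket x (bracket y z) + bracket y (- bracket x z) - bracket (bracket x y) z = 0"
    using jacobi[of x y z] bracket_skew[of z x] bracket_skew[of z "bracket x y"] by simp
  then show ?thesis by (simp add: bracket_minus_right algebra_simps)
qed

lemma bracket_derivation: "bracket (bracket x y) z = bracket (bracket x z) y + bracket x (bracket y z)"
  using bracket_bracket_left[of x y z] bracket_skew[of y "bracket x z"] by simp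

lemma lie_ideal_subspace: "lie_ideal I \<Longrightarrow> subspace I"
  by (simp add: lie_ideal_def)

lemma lie_ideal_bracket_left: "lie_ideal I \<Longrightarrow> x \<in> I \<Longrightarrow> bracket x y \<in> I"
  by (simp add: lie_ideal_def)

lemma lie_ideal_bracket_right: "lie_ideal I \<Longrightarrow> x \<in> I \<Longrightarrow> bracket y x \<in> I"
  using lie_ideal_bracket_left[of I x y] bracket_skew[of y x] subspace_neg[OF lie_ideal_subspace]
  by metis

lemma lie_ideal_UNIV: "lie_ideal UNIV"
  by (simp add: lie_ideal_def)

lemma lie_ideal_sums:
  assumes "lie_ideal I" "lie_ideal J"
  shows "lie_ideal {x + y | x y. x \<in> I \<and> y \<in> J}"
proof -
  have "subspace {x + y | x y. x \<in> I \<and> y \<in> J}"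
    using assms by (simp add: lie_ideal_def subspace_sums)
  moreover have "\<exists>x' y'. bracket (x + y) z = x' + y' \<and> x' \<in> I \<and> y' \<in> J" if "x \<in> I" "y \<in> J" for x y z
    using that assms by (metis bracket_add_left lie_ideal_bracket_left)
  ultimately show ?thesis
    unfolding lie_ideal_def by blast
qed

lemma subspace_bracket_image:
  assumes "subspace U"
  shows "subspace (bracket g ` U)"
proof (rule subspaceI)
  show "0 \<in> bracket g ` U"
    using subspace_0[OF assms] bracket_zero_right by (metis imageI)
  show "x + y \<in> bracket g ` U" if "x \<in> bracket g ` U" "y \<in> bracket g ` U" for x y
    using that subspace_add[OF assms] by (smt (verit) bracket_add_right image_iff)
  show "scale c x \<in> bracket g ` U" if "x \<in> bracket g ` U" for c x
    using that subspace_scale[OF assms] by (smt (verit) bracket_scale_right image_iff)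
qed

lemma lie_product_I: "u \<in> U \<Longrightarrow> v \<in> V \<Longrightarrow> bracket u v \<in> lie_product U V"
  unfolding lie_product_def by (rule span_base) blast

lemma lie_product_minimal:
  assumes "subspace S" "\<And>u v. u \<in> U \<Longrightarrow> v \<in> V \<Longrightarrow> bracket u v \<in> S"
  shows "lie_product U V \<subseteq> S"
  unfolding lie_product_def using assms by (intro span_minimal) auto

lemma lie_product_subset_ideal: "lie_ideal I \<Longrightarrow> lie_product I U \<subseteq> I"
  by (rule lie_product_minimal) (auto intro: lie_ideal_subspace lie_ideal_bracket_left)

lemma subspace_lie_product: "subspace (lie_product U V)"
  unfolding lie_product_def by (rule subspace_span)

lemma lie_ideal_lie_product:
  assumes "lie_ideal I" "lie_ideal J"
  shows "lie_ideal (lie_product I J)"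
  unfolding lie_ideal_def
proof (intro conjI ballI allI subspace_lie_product)
  fix x z assume "x \<in> lie_product I J"
  then show "bracket x z \<in> lie_product I J"
    unfolding lie_product_def
  proof (induction rule: span_induct_alt)
    case base
    show ?case by (simp add: span_zero)
  next
    case (step c u v)
    then obtain i j where ij: "u = bracket i j" "i \<in> I" "j \<in> J" by blast
    have "bracket u z \<in> lie_product I J"
      unfolding ij(1) bracket_derivation[of i j z]
      by (intro subspace_add subspace_lie_product lie_product_I ij
          lie_ideal_bracket_left[OF assms(1)] lie_ideal_bracket_left[OF assms(2)])
    with step show ?case
      by (simp add: bracket_add_left bracket_scale_left span_add span_scale lie_product_def)
  qed
qed

lemma lie_ideal_derived_series: "lie_ideal (derived_series n)"
  by (induction n) (auto intro: lie_ideal_UNIV lie_ideal_lie_product)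

section \<open>Exponentials preserve ideals\<close>

lemma ad_pow_mem: "lie_ideal I \<Longrightarrow> y \<in> I \<Longrightarrow> (ad x ^^ r) y \<in> I"
  by (induction r) (auto simp: ad_def intro: lie_ideal_bracket_left)

lemma ad_pow_add: "(ad x ^^ r) (y + z) = (ad x ^^ r) y + (ad x ^^ r) z"
  by (induction r) (simp_all add: ad_def bracket_add_left)

lemma ad_pow_scale: "(ad x ^^ r) (scale c y) = scale c ((ad x ^^ r) y)"
  by (induction r) (simp_all add: ad_def bracket_scale_left)

lemma ad_pow_zero [simp]: "(ad x ^^ r) 0 = 0"
  by (induction r) (simp_all add: ad_def)

lemma ad_pow_sum: "(ad x ^^ r) (\<Sum>i\<in>S. f i) = (\<Sum>i\<in>S. (ad x ^^ r) (f i))"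
  by (induction S rule: infinite_finite_induct) (simp_all add: ad_pow_add)

lemma exp_ad_mem:
  assumes "lie_ideal I" "y \<in> I"
  shows "exp_ad n x y \<in> I"
  unfolding exp_ad_def
  by (intro subspace_sum subspace_scale lie_ideal_subspace ad_pow_mem assms)

lemma exp_ad_add: "exp_ad n x (y + z) = exp_ad n x y + exp_ad n x z"
  by (simp add: exp_ad_def ad_pow_add scale_right_distrib sum.distrib)

lemma exp_ad_diff: "exp_ad n x (y - z) = exp_ad n x y - exp_ad n x z"
  using exp_ad_add[of n x "y - z" z] by simp

lemma exp_ad_tail:
  assumes "\<And>y. (ad x ^^ n) y = 0"
  shows "exp_ad n x y = y + (\<Sum>r=1..<n. scale (1 / of_nat (fact r)) ((ad x ^^ r) y))"
proof (cases n)
  case 0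
  with assms have "y = 0" "exp_ad n x y = 0" by (auto simp: exp_ad_def)
  then show ?thesis using 0 by simp
next
  case (Suc m)
  then have "{..<n} = insert 0 {1..<n}" by auto
  then show ?thesis by (simp add: exp_ad_def)
qed

text \<open>Writing \<open>\<alpha> = exp (ad x) = 1 + N\<close>, the vector \<open>w - \<alpha> w = - N w\<close> is annihilated by one power of
  \<open>ad x\<close> fewer than \<open>w\<close>. Descending this way
  gives both injectivity and surjectivity of \<open>\<alpha>\<close> on each ideal.\<close>

lemma ad_pow_diff_exp_ad:
  assumes "\<And>y. (ad x ^^ n) y = 0" "(ad x ^^ Suc k) w = 0"
  shows "(ad x ^^ k) (w - exp_ad n x w) = 0"
proof -
  have "(ad x ^^ k) ((ad x ^^ r) w) = 0" if r: "r \<in> {1..<n}" for r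
  proof -
    obtain s where "r = Suc s" using r by (cases r) auto
    then have "(ad x ^^ k) ((ad x ^^ r) w) = (ad x ^^ s) ((ad x ^^ Suc k) w)"
      by (metis add.commute add_Suc_right comp_apply funpow_add)
    then show ?thesis using assms(2) by simp
  qed
  then have z: "(ad x ^^ k) (\<Sum>r=1..<n. scale (1 / of_nat (fact r)) ((ad x ^^ r) w)) = 0"
    unfolding ad_pow_sum by (intro sum.neutral) (simp add: ad_pow_scale)
  define t where "t = (\<Sum>r=1..<n. scale (1 / of_nat (fact r)) ((ad x ^^ r) w))"
  have "w - exp_ad n x w = scale (- 1) t"
    using exp_ad_tail[OF assms(1), of w] by (simp add: t_def)
  then show ?thesis
    using z[folded t_def] by (simp only: ad_pow_scale scale_zero_right)
qed

lemma inj_exp_ad: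
  assumes nil: "\<And>y. (ad x ^^ n) y = 0"
  shows "inj (exp_ad n x)"
proof -
  have "w = 0" if "exp_ad n x w = 0" "(ad x ^^ k) w = 0" for k w
    using that
  proof (induction k)
    case (Suc k)
    then show ?case using ad_pow_diff_exp_ad[OF nil Suc.prems(2)] by simp
  qed simp
  then have "w = 0" if "exp_ad n x w = 0" for w
    using that nil by blast
  then show ?thesis
    by (intro injI) (metis eq_iff_diff_eq_0 exp_ad_diff)
qed

lemma exp_ad_image_ideal:
  assumes nil: "\<And>y. (ad x ^^ n) y = 0" and I: "lie_ideal I"
  shows "exp_ad n x ` I = I"
proof
  show "exp_ad n x ` I \<subseteq> I" using I by (auto intro: exp_ad_mem)
  have "w \<in> exp_ad n x ` I" if "w \<in> I" "(ad x ^^ k) w = 0" for k w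
    using that
  proof (induction k arbitrary: w)
    case 0
    moreover have "exp_ad n x 0 = 0" by (simp add: exp_ad_def)
    ultimately show ?case by (metis funpow_0 imageI)
  next
    case (Suc k)
    have "w - exp_ad n x w \<in> I"
      using Suc.prems(1) I by (intro subspace_diff lie_ideal_subspace exp_ad_mem)
    then obtain u where "u \<in> I" "w - exp_ad n x w = exp_ad n x u"
      using Suc.IH[OF _ ad_pow_diff_exp_ad[OF nil Suc.prems(2)]] by blast
    then have "w = exp_ad n x (u + w)" "u + w \<in> I"
      using Suc.prems(1) I by (simp_all add: exp_ad_add subspace_add lie_ideal_subspace diff_eq_eq)
    then show ?case by blast
  qed
  then show "I \<subseteq> exp_ad n x ` I" using nil by blast
qed

text \<open>In characteristic \<open>p\<close>, the first application of \<open>ad x\<close> leads into the ideal \<open>I\<close>, and each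
  further one goes down a step of its lower central series; so class less than \<open>p\<close> gives
  \<open>(ad x)\<^sup>p = 0\<close>.\<close>

lemma inner_generator_nilpotent:
  assumes "\<alpha> \<in> inner_generators"
  obtains n x where "\<alpha> = exp_ad n x" "\<And>y. (ad x ^^ n) y = 0"
proof -
  consider n x where "\<alpha> = exp_ad n x" "\<forall>y. (ad x ^^ n) y = 0"
    | x I where "\<alpha> = exp_ad CHAR('f) x" "lie_ideal I" "nilpotent I" "nilpotency_class I < CHAR('f)" "x \<in> I"
    using assms unfolding inner_generators_def by blast
  then show thesis
  proof cases
    case 1
    then show thesis using that by blast
  next
    case 2
    have lc: "(ad x ^^ Suc r) y \<in> lower_central I r" for r y
    proof (induction r)
      case 0
      show ?case using 2 by (simp add: ad_def lie_ideal_bracket_right)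
    next
      case (Suc r)
      then have "bracket ((ad x ^^ Suc r) y) x \<in> lie_product (lower_central I r) I"
        using 2 by (intro lie_product_I)
      then show ?case by (simp add: ad_def [of x "(ad x ^^ Suc r) y"] del: funpow.simps(2) add: funpow.simps(2)[of "Suc r"])
    qed
    have "lower_central I (nilpotency_class I) = {0}"
      using \<open>nilpotent I\<close> unfolding nilpotent_def nilpotency_class_def by (rule LeastI_ex)
    with lc have z: "(ad x ^^ Suc (nilpotency_class I)) y = 0" for y by blast
    have "(ad x ^^ CHAR('f)) y = 0" for y
    proof -
      obtain k where "CHAR('f) = Suc (nilpotency_class I) + k"
        using 2(4) less_eq_Suc_le le_Suc_ex by blast
      then show ?thesis using z by (simp only: funpow_add comp_apply)
    qed
    with 2 that show thesis by blast
  qed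
qed

lemma inner_generator_bij: "\<alpha> \<in> inner_generators \<Longrightarrow> bij \<alpha>"
  by (metis bij_def exp_ad_image_ideal inj_exp_ad inner_generator_nilpotent lie_ideal_UNIV)

lemma inner_automorphism_preserves_ideals:
  assumes "\<alpha> \<in> inner_automorphisms"
  shows "bij \<alpha> \<and> (\<forall>I. lie_ideal I \<longrightarrow> \<alpha> ` I = I)"
  using assms unfolding inner_automorphisms_def
proof (induction rule: generate.induct)
  case one
  show ?case by (simp add: BijGroup_def bij_id[unfolded id_def])
next
  case (incl h)
  then show ?case
    using inner_generator_bij by (metis exp_ad_image_ideal inner_generator_nilpotent)
next
  case (inv h)
  have b: "bij h" using inv by (rule inner_generator_bij)
  have "\<forall>I. lie_ideal I \<longrightarrow> h ` I = I"
    using inv by (metis exp_ad_image_ideal inner_generator_nilpotent)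
  moreover have "inv\<^bsub>BijGroup UNIV\<^esub> h = inv_into UNIV h"
    using b by (subst inv_BijGroup) (auto simp: Bij_def)
  ultimately show ?case
    using b by (simp add: bij_imp_bij_inv) (metis bij_is_inj image_inv_f_f)
next
  case (eng h1 h2)
  then have "h1 \<otimes>\<^bsub>BijGroup UNIV\<^esub> h2 = h1 \<circ> h2"
    by (simp add: BijGroup_def Bij_def compose_def fun_eq_iff)
  with eng show ?case by (metis bij_comp image_comp)
qed

lemma core_eq_if_conjugate:
  assumes "subspace M" "subspace K" "conjugate M K"
  shows "core M = core K"
proof -
  obtain \<alpha> where \<alpha>: "bij \<alpha>" "\<And>I. lie_ideal I \<Longrightarrow> \<alpha> ` I = I" "M = \<alpha> ` K"
    using assms(3) inner_automorphism_preserves_ideals unfolding conjugate_def by blast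
  have "I \<subseteq> M \<longleftrightarrow> I \<subseteq> K" if "lie_ideal I" for I
    using \<alpha>(2)[OF that] \<alpha>(1,3) by (metis bij_is_inj inj_image_subset_iff)
  then show ?thesis
    by (meson antisym assms(1,2) core_greatest core_subset lie_ideal_core)
qed

section \<open>Jacobson's lemma on nilpotent commutators\<close>

text \<open>The value of the polynomial \<open>p\<close> at the linear map \<open>bracket a\<close>, by Horner's scheme.\<close>

definition bracket_poly :: "'a \<Rightarrow> 'f poly \<Rightarrow> 'a \<Rightarrow> 'a" where
  "bracket_poly a p = fold_coeffs (\<lambda>c g v. scale c v + bracket a (g v)) p (\<lambda>v. 0)"

lemma bracket_poly_0 [simp]: "bracket_poly a 0 v = 0"
  by (simp add: bracket_poly_def)

lemma bracket_poly_pCons [simp]: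
  "bracket_poly a (pCons c p) v = scale c v + bracket a (bracket_poly a p v)"
  by (cases "c = 0 \<and> p = 0") (auto simp: bracket_poly_def)

lemma bracket_poly_zero_right [simp]: "bracket_poly a p 0 = 0"
  by (induction p) simp_all

lemma bracket_poly_add_right: "bracket_poly a p (u + v) = bracket_poly a p u + bracket_poly a p v"
  by (induction p) (simp_all add: scale_right_distrib bracket_add_right)

lemma bracket_poly_scale_right: "bracket_poly a p (scale c v) = scale c (bracket_poly a p v)"
  by (induction p) (simp_all add: scale_right_distrib bracket_scale_right mult.commute)

lemma bracket_poly_add: "bracket_poly a (p + q) v = bracket_poly a p v + bracket_poly a q v"
  by (induction p q rule: poly_induct2) (simp_all add: scale_left_distrib bracket_add_right algebra_simps)

lemma bracket_poly_smult: "bracket_poly a (smult c p) v = scale c (bracket_poly a p v)"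
  by (induction p) (simp_all add: scale_right_distrib bracket_scale_right)

lemma bracket_poly_mult: "bracket_poly a (p * q) v = bracket_poly a p (bracket_poly a q v)"
  by (induction p) (simp_all add: bracket_poly_add bracket_poly_smult)

lemma bracket_poly_monom: "bracket_poly a (monom 1 i) v = (bracket a ^^ i) v"
  by (induction i) (simp_all add: monom_Suc monom_0)

lemma bracket_poly_mem: "lie_ideal I \<Longrightarrow> v \<in> I \<Longrightarrow> bracket_poly a p v \<in> I"
  by (induction p)
    (auto intro!: subspace_add subspace_scale lie_ideal_subspace lie_ideal_bracket_right subspace_0)

lemma bracket_pow_add: "(bracket c ^^ k) (u + v) = (bracket c ^^ k) u + (bracket c ^^ k) v"
  by (induction k) (simp_all add: bracket_add_right)

lemma bracket_pow_mem: "lie_ideal I \<Longrightarrow> v \<in> I \<Longrightarrow> (bracket c ^^ k) v \<in> I"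
  by (induction k) (auto intro: lie_ideal_bracket_right)

definition factor_centralizer :: "'a set \<Rightarrow> 'a set \<Rightarrow> 'a set" where
  "factor_centralizer W' W = {x. \<forall>w\<in>W. bracket x w \<in> W'}"

lemma factor_centralizerD: "x \<in> factor_centralizer W' W \<Longrightarrow> w \<in> W \<Longrightarrow> bracket x w \<in> W'"
  by (simp add: factor_centralizer_def)

lemma lie_ideal_factor_centralizer:
  assumes "lie_ideal W'" "lie_ideal W"
  shows "lie_ideal (factor_centralizer W' W)"
  unfolding lie_ideal_def
proof (intro conjI ballI allI)
  have W': "subspace W'" using assms by (simp add: lie_ideal_subspace)
  show "subspace (factor_centralizer W' W)"
    by (auto simp: subspace_def factor_centralizer_def bracket_add_left bracket_scale_left
        subspace_0[OF W'] subspace_add[OF W'] subspace_scale[OF W'])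
  fix x y assume x: "x \<in> factor_centralizer W' W"
  have "bracket (bracket x y) w \<in> W'" if "w \<in> W" for w
    unfolding bracket_bracket_left using x assms that
    by (intro subspace_diff[OF W']) (auto intro: lie_ideal_bracket_right simp: factor_centralizer_def)
  then show "bracket x y \<in> factor_centralizer W' W"
    by (simp add: factor_centralizer_def)
qed

lemma bracket_poly_commute_mod:
  assumes W: "lie_ideal W'" "lie_ideal W" and comm: "bracket y a \<in> factor_centralizer W' W"
    and v: "v \<in> W"
  shows "bracket y (bracket_poly a p v) - bracket_poly a p (bracket y v) \<in> W'"
proof (induction p)
  case 0
  show ?case using W by (simp add: lie_ideal_subspace subspace_0)
next
  case (pCons \<alpha> p)
  have "bracket y (bracket_poly a (pCons \<alpha> p) v) - bracket_poly a (pCons \<alpha> p) (bracket y v)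
      = bracket (bracket y a) (bracket_poly a p v)
        + bracket a (bracket y (bracket_poly a p v) - bracket_poly a p (bracket y v))"
    by (simp add: bracket_add_right bracket_scale_right bracket_diff_right bracket_bracket_left)
  also have "\<dots> \<in> W'"
    using W comm v pCons.IH
    by (intro subspace_add lie_ideal_subspace lie_ideal_bracket_right[of W']
        factor_centralizerD[OF comm] bracket_poly_mem)
  finally show ?case .
qed

lemma bracket_pow_poly_commute_mod:
  assumes W: "lie_ideal W'" "lie_ideal W" and comm: "bracket c a \<in> factor_centralizer W' W"
    and v: "v \<in> W"
  shows "(bracket c ^^ k) (bracket_poly a p v) - bracket_poly a p ((bracket c ^^ k) v) \<in> W'"
proof (induction k)
  case 0
  show ?case using W by (simp add: lie_ideal_subspace subspace_0)
next
  case (Suc k)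
  have "(bracket c ^^ Suc k) (bracket_poly a p v) - bracket_poly a p ((bracket c ^^ Suc k) v)
      = bracket c ((bracket c ^^ k) (bracket_poly a p v) - bracket_poly a p ((bracket c ^^ k) v))
        + (bracket c (bracket_poly a p ((bracket c ^^ k) v))
           - bracket_poly a p (bracket c ((bracket c ^^ k) v)))"
    by (simp add: bracket_diff_right)
  also have "\<dots> \<in> W'"
    using W comm v Suc.IH
    by (intro subspace_add lie_ideal_subspace lie_ideal_bracket_right[of W']
        bracket_poly_commute_mod[OF W comm] bracket_pow_mem)
  finally show ?case .
qed

text \<open>On \<open>W / W'\<close> the element \<open>c = [x, a]\<close> commutes with \<open>a\<close>, hence \<open>[x, p(a)] = p'(a) c\<close>, just as in
  the Weyl algebra.\<close>

lemma bracket_poly_commutator_mod: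
  assumes W: "lie_ideal W'" "lie_ideal W" and c: "c = bracket x a"
    and comm: "bracket c a \<in> factor_centralizer W' W" and v: "v \<in> W"
  shows "bracket x (bracket_poly a p v) - bracket_poly a p (bracket x v)
           - bracket_poly a (pderiv p) (bracket c v) \<in> W'"
proof (induction p)
  case 0
  show ?case using W by (simp add: lie_ideal_subspace subspace_0)
next
  case (pCons \<alpha> p)
  have "bracket x (bracket_poly a (pCons \<alpha> p) v) - bracket_poly a (pCons \<alpha> p) (bracket x v)
           - bracket_poly a (pderiv (pCons \<alpha> p)) (bracket c v)
      = (bracket c (bracket_poly a p v) - bracket_poly a p (bracket c v))
        + bracket a (bracket x (bracket_poly a p v) - bracket_poly a p (bracket x v)
           - bracket_poly a (pderiv p) (bracket c v))"
    by (simp add: pderiv_pCons bracket_poly_add bracket_add_right bracket_scale_right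
        bracket_diff_right bracket_bracket_left c)
  also have "\<dots> \<in> W'"
    using W v pCons.IH
    by (intro subspace_add lie_ideal_subspace lie_ideal_bracket_right[of W']
        bracket_poly_commute_mod[OF W comm])
  finally show ?case .
qed

text \<open>If \<open>p(a) c\<^sup>k\<close> vanishes on \<open>W / W'\<close>, then sandwiching \<open>[x, p(a)] = p'(a) c\<close> between two factors
  \<open>c\<^sup>k\<close> kills the left-hand side and leaves \<open>p'(a) c\<^sup>2\<^sup>k\<^sup>+\<^sup>1 = 0\<close>. In characteristic zero, repeated
  differentiation ends in a nonzero constant, which shows that a power of \<open>c\<close> vanishes.\<close>

lemma commutator_nilpotent_if_annihilated:
  assumes char: "CHAR('f) = 0"
    and W: "lie_ideal W'" "lie_ideal W" and c: "c = bracket x a"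
    and comm: "bracket c a \<in> factor_centralizer W' W"
    and "p \<noteq> 0" "\<And>v. v \<in> W \<Longrightarrow> bracket_poly a p ((bracket c ^^ k) v) \<in> W'"
  shows "\<exists>n. \<forall>v\<in>W. (bracket c ^^ n) v \<in> W'"
  using assms(6,7)
proof (induction "degree p" arbitrary: p k rule: less_induct)
  case less
  have sW': "subspace W'" using W by (simp add: lie_ideal_subspace)
  show ?case
  proof (cases "degree p = 0")
    case True
    then obtain \<alpha> where p: "p = [:\<alpha>:]" "\<alpha> \<noteq> 0"
      using degree_eq_zeroE less.prems(1) by (metis pCons_0_0)
    have "(bracket c ^^ k) v \<in> W'" if "v \<in> W" for v
    proof -
      have "scale \<alpha> ((bracket c ^^ k) v) \<in> W'"
        using less.prems(2)[OF that] p by simp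
      then have "scale (1 / \<alpha>) (scale \<alpha> ((bracket c ^^ k) v)) \<in> W'"
        by (rule subspace_scale[OF sW'])
      then show ?thesis using p by simp
    qed
    then show ?thesis by blast
  next
    case False
    then obtain d where d: "degree p = Suc d" using not0_implies_Suc by blast
    have "coeff (pderiv p) d = of_nat (Suc d) * lead_coeff p"
      by (simp add: coeff_pderiv d)
    moreover have "of_nat (Suc d) \<noteq> (0 :: 'f)"
      using char of_nat_eq_0_iff_char_dvd[where 'a = 'f, of "Suc d"] by simp
    ultimately have nz: "pderiv p \<noteq> 0" using less.prems(1) by auto
    have deg: "degree (pderiv p) < degree p"
      unfolding d less_Suc_eq_le
      by (intro degree_le) (auto simp: coeff_pderiv d intro!: coeff_eq_0)
    have "bracket_poly a (pderiv p) ((bracket c ^^ (2 * k + 1)) v) \<in> W'" if v: "v \<in> W" for v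
    proof -
      define u where "u = (bracket c ^^ k) v"
      have u: "u \<in> W" unfolding u_def using W(2) v by (rule bracket_pow_mem)
      have "bracket x (bracket_poly a p u) \<in> W'"
        unfolding u_def by (intro lie_ideal_bracket_right W less.prems v)
      with bracket_poly_commutator_mod[OF W c comm u, of p]
      have "bracket_poly a p (bracket x u) + bracket_poly a (pderiv p) (bracket c u) \<in> W'"
        using subspace_diff[OF sW'] by (metis add.commute diff_diff_eq diff_diff_eq2 add_diff_cancel_left')
      then have 1: "(bracket c ^^ k) (bracket_poly a p (bracket x u)
          + bracket_poly a (pderiv p) (bracket c u)) \<in> W'"
        by (rule bracket_pow_mem[OF W(1)])
      have xu: "bracket x u \<in> W" using W u by (simp add: lie_ideal_bracket_right)
      have cu: "bracket c u \<in> W" using W u by (simp add: lie_ideal_bracket_right)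
      have "(bracket c ^^ k) (bracket_poly a p (bracket x u)) \<in> W'"
        using bracket_pow_poly_commute_mod[OF W comm xu, of k p] less.prems(2)[OF xu]
        by (metis diff_add_cancel subspace_add[OF sW'])
      then have 2: "(bracket c ^^ k) (bracket_poly a (pderiv p) (bracket c u)) \<in> W'"
        using 1 unfolding bracket_pow_add by (metis add_diff_cancel_left' subspace_diff[OF sW'])
      have 3: "bracket_poly a (pderiv p) ((bracket c ^^ k) (bracket c u)) \<in> W'"
        using subspace_diff[OF sW' 2 bracket_pow_poly_commute_mod[OF W comm cu, of k "pderiv p"]]
        by simp
      have "2 * k + 1 = k + Suc k" by simp
      then have "(bracket c ^^ (2 * k + 1)) v = (bracket c ^^ k) (bracket c u)"
        by (simp only: funpow_add u_def comp_apply funpow.simps)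
      then show ?thesis using 3 by (simp only:)
    qed
    with less.hyps[OF deg nz] show ?thesis by blast
  qed
qed

end

locale fin_dim_lie_algebra = lie_algebra scale bracket + finite_dimensional_vector_space scale Basis
  for scale :: "'f::field \<Rightarrow> 'a::ab_group_add \<Rightarrow> 'a" and bracket Basis
begin

text \<open>The powers \<open>a\<^sup>i v\<close> cannot all be linearly independent.\<close>

lemma bracket_poly_annihilates_vector: "\<exists>p. p \<noteq> 0 \<and> bracket_poly a p v = 0"
proof -
  define U where "U n = (\<lambda>i. (bracket a ^^ i) v) ` {..<n}" for n
  have U_Suc: "U (Suc n) = insert ((bracket a ^^ n) v) (U n)" for n
    by (auto simp: U_def lessThan_Suc)
  have "\<exists>n. (bracket a ^^ n) v \<in> span (U n)"
  proof (rule ccontr)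
    assume ind: "\<nexists>n. (bracket a ^^ n) v \<in> span (U n)"
    have "n \<le> dim (U n)" for n
    proof (induction n)
      case (Suc n)
      then show ?case using ind by (simp add: U_Suc dim_insert)
    qed simp
    from this[of "Suc dimension"] show False
      using dim_subset_UNIV[of "U (Suc dimension)"] by simp
  qed
  then obtain n where n: "(bracket a ^^ n) v \<in> span (U n)" by blast
  have "\<exists>q. (\<forall>i\<ge>n. coeff q i = 0) \<and> bracket_poly a q v = u" if "u \<in> span (U n)" for u
    using that
  proof (induction rule: span_induct_alt)
    case base
    show ?case by (intro exI[of _ 0]) simp
  next
    case (step c y z)
    then obtain i q where "i < n" "y = (bracket a ^^ i) v" "\<forall>i\<ge>n. coeff q i = 0" "bracket_poly a q v = z"
      by (auto simp: U_def)
    then show ?case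
      by (intro exI[of _ "smult c (monom 1 i) + q"])
        (auto simp: bracket_poly_add bracket_poly_smult bracket_poly_monom)
  qed
  then obtain q where q: "\<forall>i\<ge>n. coeff q i = 0" "bracket_poly a q v = (bracket a ^^ n) v"
    using n by blast
  define p where "p = monom 1 n + smult (- 1) q"
  have "coeff p n = 1" using q by (simp add: p_def)
  then have "p \<noteq> 0" by auto
  moreover have "bracket_poly a p v = 0"
    unfolding p_def bracket_poly_add bracket_poly_smult bracket_poly_monom q(2) by simp
  ultimately show ?thesis by blast
qed

text \<open>Multiply polynomials that annihilate the individual basis vectors.\<close>

lemma bracket_poly_annihilates: "\<exists>p. p \<noteq> 0 \<and> (\<forall>v. bracket_poly a p v = 0)"
proof -
  have "\<exists>p. p \<noteq> 0 \<and> (\<forall>v\<in>B. bracket_poly a p v = 0)" if "finite B" for B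
    using that
  proof (induction B)
    case empty
    show ?case by (intro exI[of _ 1]) simp
  next
    case (insert b B)
    obtain q where q: "q \<noteq> 0" "\<forall>v\<in>B. bracket_poly a q v = 0" using insert.IH by blast
    obtain r where r: "r \<noteq> 0" "bracket_poly a r b = 0"
      using bracket_poly_annihilates_vector by blast
    have "bracket_poly a (r * q) v = 0" if "v \<in> B" for v
      using q that by (simp add: bracket_poly_mult)
    moreover have "bracket_poly a (r * q) b = 0"
      using r by (subst mult.commute) (simp add: bracket_poly_mult)
    ultimately show ?case
      using q r by (intro exI[of _ "r * q"]) auto
  qed
  then obtain p where p: "p \<noteq> 0" "\<forall>v\<in>Basis. bracket_poly a p v = 0"
    using finite_Basis by blast
  have "bracket_poly a p v = 0" for v
  proof -
    have "v \<in> span Basis" by (simp add: span_Basis)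
    then show ?thesis
      by (induction rule: span_induct_alt)
        (use p in \<open>simp_all add: bracket_poly_add_right bracket_poly_scale_right\<close>)
  qed
  with p show ?thesis by blast
qed

lemma commutator_nilpotent_mod:
  assumes "CHAR('f) = 0" "lie_ideal W'" "lie_ideal W"
    and "bracket (bracket x a) a \<in> factor_centralizer W' W"
  shows "\<exists>n. \<forall>v\<in>W. (bracket (bracket x a) ^^ n) v \<in> W'"
proof -
  obtain p where "p \<noteq> 0" "\<And>v. bracket_poly a p v = 0" using bracket_poly_annihilates by blast
  then show ?thesis
    using commutator_nilpotent_if_annihilated[OF assms(1-3) refl assms(4), of p 0]
      subspace_0[OF lie_ideal_subspace[OF assms(2)]] by simp
qed

end

section \<open>Chief factors are centralised by the derived algebra\<close>

context lie_algebra
begin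

definition chief_factor :: "'a set \<Rightarrow> 'a set \<Rightarrow> bool" where
  "chief_factor W' W \<longleftrightarrow> lie_ideal W' \<and> lie_ideal W \<and> W' \<subset> W \<and>
     (\<forall>J. lie_ideal J \<and> W' \<subseteq> J \<and> J \<subseteq> W \<longrightarrow> J = W' \<or> J = W)"

lemma chief_factorD:
  assumes "chief_factor W' W"
  shows "lie_ideal W'" "lie_ideal W" "W' \<subset> W" "subspace W'" "subspace W"
  using assms by (auto simp: chief_factor_def lie_ideal_subspace)

lemma chief_factor_between:
  "chief_factor W' W \<Longrightarrow> lie_ideal J \<Longrightarrow> W' \<subseteq> J \<Longrightarrow> J \<subseteq> W \<Longrightarrow> J = W' \<or> J = W"
  by (simp add: chief_factor_def)

lemma chief_factor_sum:
  assumes chief: "chief_factor W' W" and J: "lie_ideal J" "J \<subseteq> W" "\<not> J \<subseteq> W'" and "w \<in> W"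
  obtains j v where "j \<in> J" "v \<in> W'" "w = j + v"
proof -
  note D = chief_factorD[OF chief]
  define S where "S = {j + v | j v. j \<in> J \<and> v \<in> W'}"
  have "lie_ideal S" unfolding S_def by (rule lie_ideal_sums[OF J(1) D(1)])
  moreover have "W' \<subseteq> S"
    unfolding S_def using subspace_0[OF lie_ideal_subspace[OF J(1)]] by force
  moreover have "S \<subseteq> W"
    unfolding S_def using J D by (auto intro!: subspace_add[OF D(5)])
  moreover have "J \<subseteq> S"
    unfolding S_def using subspace_0[OF D(4)] by force
  ultimately have "S = W" using chief_factor_between[OF chief] J(3) by blast
  then show thesis using \<open>w \<in> W\<close> that unfolding S_def by blast
qed

abbreviation derived_algebra :: "'a set" where
  "derived_algebra \<equiv> lie_product UNIV UNIV"

lemma lie_ideal_derived_algebra: "lie_ideal derived_algebra"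
  by (intro lie_ideal_lie_product lie_ideal_UNIV)

text \<open>If \<open>L\<^sup>2\<close> did not centralise \<open>W / W'\<close>, then \<open>W = [W, L\<^sup>2] + W'\<close>, and iterating this pushes
  \<open>W\<close> into \<open>W'\<close> along the lower central series of \<open>L\<^sup>2\<close>.\<close>

lemma derived_algebra_centralizes_if_nilpotent:
  assumes nil: "nilpotent derived_algebra" and chief: "chief_factor W' W"
  shows "derived_algebra \<subseteq> factor_centralizer W' W"
proof (rule ccontr)
  note D = chief_factorD[OF chief]
  define P where "P = lie_product W derived_algebra"
  assume "\<not> derived_algebra \<subseteq> factor_centralizer W' W"
  then obtain x w where xw: "x \<in> derived_algebra" "w \<in> W" "bracket x w \<notin> W'"
    by (auto simp: factor_centralizer_def)
  then have "bracket w x \<notin> W'" using bracket_skew[of x w] subspace_neg[OF D(4)] by metis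
  then have not: "\<not> P \<subseteq> W'" unfolding P_def using lie_product_I[OF xw(2,1)] by blast
  have P: "lie_ideal P" "P \<subseteq> W"
    unfolding P_def
    by (rule lie_ideal_lie_product[OF D(2) lie_ideal_derived_algebra])
      (rule lie_product_subset_ideal[OF D(2)])
  have lc: "\<exists>l\<in>lower_central derived_algebra n. \<exists>v\<in>W'. w = l + v" if "w \<in> W" for n w
    using that
  proof (induction n arbitrary: w)
    case 0
    have "P \<subseteq> derived_algebra"
      unfolding P_def lie_product_def by (rule span_mono) blast
    then show ?case using chief_factor_sum[OF chief P not 0] by (metis lower_central.simps(1) subsetD)
  next
    case (Suc n)
    define S where "S = {l + v | l v. l \<in> lower_central derived_algebra (Suc n) \<and> v \<in> W'}"
    have "subspace S"
      unfolding S_def using D by (intro subspace_sums) (simp_all add: subspace_lie_product)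
    moreover have "bracket u y \<in> S" if "u \<in> W" "y \<in> derived_algebra" for u y
    proof -
      obtain l v where lv: "l \<in> lower_central derived_algebra n" "v \<in> W'" "u = l + v"
        using Suc.IH[OF \<open>u \<in> W\<close>] by blast
      then have "bracket u y = bracket l y + bracket v y"
        "bracket l y \<in> lower_central derived_algebra (Suc n)" "bracket v y \<in> W'"
        using that D by (auto simp: bracket_add_left intro: lie_product_I lie_ideal_bracket_left)
      then show ?thesis unfolding S_def by blast
    qed
    ultimately have PS: "P \<subseteq> S" unfolding P_def by (rule lie_product_minimal)
    obtain j v where jv: "j \<in> P" "v \<in> W'" "w = j + v"
      using chief_factor_sum[OF chief P not Suc.prems] by blast
    then obtain l v' where "l \<in> lower_central derived_algebra (Suc n)" "v' \<in> W'" "j = l + v'"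
      using PS unfolding S_def by blast
    with jv show ?case
      by (metis add.assoc subspace_add[OF D(4)])
  qed
  obtain n where "lower_central derived_algebra n = {0}" using nil by (auto simp: nilpotent_def)
  then have "W \<subseteq> W'" using lc[of _ n] by auto
  then show False using D(3) by blast
qed

end

context fin_dim_lie_algebra
begin

lemma psubspace_dim_less: "subspace S \<Longrightarrow> subspace T \<Longrightarrow> S \<subset> T \<Longrightarrow> dim S < dim T"
  using dim_psubset[of S T] by (metis span_eq_iff)

lemma chief_factor_above:
  assumes "lie_ideal C" "C \<noteq> UNIV"
  obtains A where "chief_factor C A"
proof -
  have "lie_ideal UNIV \<and> C \<subset> UNIV" using assms lie_ideal_UNIV by blast
  from ex_has_least_nat[of "\<lambda>A. lie_ideal A \<and> C \<subset> A", OF this, of dim]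
  obtain A where A: "lie_ideal A" "C \<subset> A"
      "\<And>B. lie_ideal B \<Longrightarrow> C \<subset> B \<Longrightarrow> dim A \<le> dim B" by blast
  have "chief_factor C A"
    unfolding chief_factor_def
  proof (intro conjI allI impI A assms)
    fix J assume "lie_ideal J \<and> C \<subseteq> J \<and> J \<subseteq> A"
    then show "J = C \<or> J = A"
      using A psubspace_dim_less[of J A] by (metis lie_ideal_subspace not_less psubsetI)
  qed
  then show thesis by (rule that)
qed

lemma chief_factor_below:
  assumes "lie_ideal W" "W \<noteq> {0}"
  obtains W' where "chief_factor W' W"
proof -
  have "lie_ideal {0}" by (simp add: lie_ideal_def subspace_single_0)
  moreover have "{0} \<subset> W"
    using assms subspace_0[OF lie_ideal_subspace] by blast
  ultimately have "lie_ideal {0} \<and> {0} \<subset> W" by blast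
  from ex_has_greatest_nat[of "\<lambda>V. lie_ideal V \<and> V \<subset> W", OF this, of dim "Suc dimension"]
  obtain W' where W': "lie_ideal W'" "W' \<subset> W"
      "\<And>B. lie_ideal B \<Longrightarrow> B \<subset> W \<Longrightarrow> dim B \<le> dim W'"
    using dim_subset_UNIV by (auto simp: less_Suc_eq_le)
  have "chief_factor W' W"
    unfolding chief_factor_def
  proof (intro conjI allI impI W' assms)
    fix J assume "lie_ideal J \<and> W' \<subseteq> J \<and> J \<subseteq> W"
    then show "J = W' \<or> J = W"
      using W' psubspace_dim_less[of W' J] by (metis lie_ideal_subspace not_less psubsetI)
  qed
  then show thesis by (rule that)
qed

text \<open>A commuting family of operators that are nilpotent on \<open>W / W'\<close> kills a nonzero subspace
  \<open>U / W'\<close>, namely any minimal invariant one, since \<open>g U + W'\<close> is again invariant and smaller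
  than \<open>U\<close>. As the family spans an ideal, its common kernel is an ideal, hence all of \<open>W / W'\<close>.\<close>

lemma commuting_nilpotent_centralizes:
  assumes chief: "chief_factor W' W"
    and S: "lie_ideal (span G)"
    and comm: "\<And>s t. s \<in> span G \<Longrightarrow> t \<in> span G \<Longrightarrow> bracket s t \<in> factor_centralizer W' W"
    and nil: "\<And>g. g \<in> G \<Longrightarrow> \<exists>n. \<forall>w\<in>W. (bracket g ^^ n) w \<in> W'"
  shows "span G \<subseteq> factor_centralizer W' W"
proof -
  note D = chief_factorD[OF chief]
  define invariant where "invariant U \<longleftrightarrow> subspace U \<and> W' \<subset> U \<and> U \<subseteq> W \<and> (\<forall>s\<in>span G. \<forall>u\<in>U. bracket s u \<in> U)" for U
  have "invariant W" unfolding invariant_def using D by (blast intro: lie_ideal_bracket_right)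
  from ex_has_least_nat[of invariant, OF this, of dim]
  obtain U where U: "invariant U" "\<And>V. invariant V \<Longrightarrow> dim U \<le> dim V" by blast
  then have sU: "subspace U" "W' \<subset> U" "U \<subseteq> W"
    and Uinv: "\<And>s u. s \<in> span G \<Longrightarrow> u \<in> U \<Longrightarrow> bracket s u \<in> U"
    by (auto simp: invariant_def)
  have gU: "bracket g u \<in> W'" if g: "g \<in> G" and u: "u \<in> U" for g u
  proof -
    have gs: "g \<in> span G" using g by (rule span_base)
    define V where "V = {x + y | x y. x \<in> bracket g ` U \<and> y \<in> W'}"
    have sV: "subspace V"
      unfolding V_def using subspace_bracket_image[OF sU(1)] D(4) by (rule subspace_sums)
    have W'V: "W' \<subseteq> V"
    proof
      fix y assume "y \<in> W'"
      then have "y = bracket g 0 + y" "y \<in> W'" by simp_all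
      then show "y \<in> V" unfolding V_def using subspace_0[OF sU(1)] by blast
    qed
    have VU: "V \<subseteq> U"
      unfolding V_def using Uinv[OF gs] sU by (auto intro!: subspace_add[OF sU(1)])
    have Vinv: "bracket s v \<in> V" if s: "s \<in> span G" and "v \<in> V" for s v
    proof -
      obtain u' y where v: "u' \<in> U" "y \<in> W'" "v = bracket g u' + y"
        using \<open>v \<in> V\<close> unfolding V_def by blast
      have "bracket s v = bracket g (bracket s u') + (bracket (bracket s g) u' + bracket s y)"
        by (simp add: v(3) bracket_add_right bracket_bracket_left)
      moreover have "bracket s u' \<in> U" using Uinv s v by blast
      moreover have "bracket (bracket s g) u' + bracket s y \<in> W'"
        using comm[OF s gs] v sU D
        by (intro subspace_add[OF D(4)]) (auto dest: factor_centralizerD intro: lie_ideal_bracket_right)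
      ultimately show ?thesis unfolding V_def by blast
    qed
    have "V = W'"
    proof (rule ccontr)
      assume "V \<noteq> W'"
      then have "invariant V" unfolding invariant_def using sV W'V VU Vinv sU by blast
      then have "dim U \<le> dim V" by (rule U(2))
      then have VU: "V = U" using VU sV sU psubspace_dim_less[of V U] by force
      \<comment> \<open>Iterating \<open>U = g U + W'\<close> gives \<open>U = g\<^sup>n U + W'\<close>, contrary to nilpotency.\<close>
      have iter: "\<exists>u'\<in>U. \<exists>y\<in>W'. u = (bracket g ^^ n) u' + y" if "u \<in> U" for u n
      proof (induction n)
        case 0
        show ?case using that subspace_0[OF D(4)] by force
      next
        case (Suc n)
        then obtain u' y where 1: "u' \<in> U" "y \<in> W'" "u = (bracket g ^^ n) u' + y" by blast
        then obtain u'' y' where 2: "u'' \<in> U" "y' \<in> W'" "u' = bracket g u'' + y'"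
          using VU unfolding V_def by blast
        then have "u = (bracket g ^^ Suc n) u'' + ((bracket g ^^ n) y' + y)"
          using 1 2 by (simp add: bracket_pow_add funpow_swap1 add.assoc)
        moreover have "(bracket g ^^ n) y' + y \<in> W'"
          using 1 2 by (intro subspace_add[OF D(4)] bracket_pow_mem[OF D(1)])
        ultimately show ?case using 2 by blast
      qed
      obtain n where n: "\<forall>w\<in>W. (bracket g ^^ n) w \<in> W'" using nil[OF g] by blast
      have "U \<subseteq> W'"
      proof
        fix u assume "u \<in> U"
        from iter[OF this, of n] n sU show "u \<in> W'" by (auto intro!: subspace_add[OF D(4)])
      qed
      then show False using sU by blast
    qed
    moreover have "bracket g u + 0 \<in> V" unfolding V_def using u subspace_0[OF D(4)] by blast
    ultimately show ?thesis by simp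
  qed
  have SU: "bracket s u \<in> W'" if "s \<in> span G" "u \<in> U" for s u
    using that(1)
    by (induction rule: span_induct_alt)
      (use gU that(2) D(4) in \<open>auto simp: bracket_add_left bracket_scale_left
        intro!: subspace_add subspace_scale subspace_0\<close>)
  define Z where "Z = {w \<in> W. \<forall>s\<in>span G. bracket s w \<in> W'}"
  have "lie_ideal Z"
    unfolding lie_ideal_def
  proof (intro conjI ballI allI)
    show "subspace Z"
      unfolding Z_def subspace_def
      by (auto simp: bracket_add_right bracket_scale_right
          intro: subspace_0[OF D(4)] subspace_add[OF D(4)] subspace_scale[OF D(4)]
          subspace_0[OF D(5)] subspace_add[OF D(5)] subspace_scale[OF D(5)])
    fix z y assume z: "z \<in> Z"
    have "bracket s (bracket z y) \<in> W'" if s: "s \<in> span G" for s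
    proof -
      have "bracket s (bracket z y) = bracket (bracket s z) y - bracket (bracket s y) z"
        using bracket_derivation[of s z y] by simp
      moreover have "bracket (bracket s z) y \<in> W'"
        using z s D by (auto simp: Z_def intro: lie_ideal_bracket_left)
      moreover have "bracket (bracket s y) z \<in> W'"
        using z lie_ideal_bracket_left[OF S s] by (auto simp: Z_def)
      ultimately show ?thesis using subspace_diff[OF D(4)] by simp
    qed
    then show "bracket z y \<in> Z" using z D by (auto simp: Z_def intro: lie_ideal_bracket_left)
  qed
  moreover have "W' \<subseteq> Z" "Z \<subseteq> W" unfolding Z_def using D by (auto intro: lie_ideal_bracket_right)
  moreover have "U \<subseteq> Z" unfolding Z_def using SU sU by blast
  ultimately have "Z = W" using chief_factor_between[OF chief] sU by blast
  then show ?thesis unfolding Z_def factor_centralizer_def by blast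
qed

lemma lie_product_centralizes_char0:
  assumes char: "CHAR('f) = 0" and chief: "chief_factor W' W"
    and I: "lie_ideal I" and J: "lie_ideal J"
    and comm: "\<And>x y. x \<in> I \<Longrightarrow> y \<in> J \<Longrightarrow> bracket (bracket x y) y \<in> factor_centralizer W' W"
    and abel: "\<And>s t. s \<in> lie_product I J \<Longrightarrow> t \<in> lie_product I J \<Longrightarrow>
        bracket s t \<in> factor_centralizer W' W"
  shows "lie_product I J \<subseteq> factor_centralizer W' W"
  unfolding lie_product_def
proof (rule commuting_nilpotent_centralizes[OF chief])
  show "lie_ideal (span {bracket u v |u v. u \<in> I \<and> v \<in> J})"
    using lie_ideal_lie_product[OF I J] by (simp add: lie_product_def)
  show "\<exists>n. \<forall>w\<in>W. (bracket g ^^ n) w \<in> W'" if "g \<in> {bracket u v |u v. u \<in> I \<and> v \<in> J}" for g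
    using that comm commutator_nilpotent_mod[OF char chief_factorD(1,2)[OF chief]] by blast
qed (use abel in \<open>simp add: lie_product_def\<close>)

text \<open>A form of Lie's theorem. Suppose that the last derived term \<open>S\<close> that acts nontrivially on
  \<open>W / W'\<close> lies in \<open>L\<^sup>2\<close>. It acts by commuting operators, so Jacobson's lemma shows first that
  \<open>[L, S]\<close> acts trivially, and then that \<open>S\<close> itself, being spanned by commutators that now act
  centrally, does so too.\<close>

lemma derived_algebra_centralizes_char0:
  assumes char: "CHAR('f) = 0" and solv: "solvable" and chief: "chief_factor W' W"
  shows "derived_algebra \<subseteq> factor_centralizer W' W"
proof -
  define Z where "Z = factor_centralizer W' W"
  note D = chief_factorD[OF chief]
  have Z: "lie_ideal Z" unfolding Z_def using D by (intro lie_ideal_factor_centralizer)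
  then have sZ: "subspace Z" by (rule lie_ideal_subspace)
  obtain n where "derived_series n = {0}" using solv by (auto simp: solvable_def)
  then have ex: "derived_series n \<subseteq> Z" using subspace_0[OF sZ] by simp
  define k where "k = (LEAST k. derived_series k \<subseteq> Z)"
  have k: "derived_series k \<subseteq> Z" unfolding k_def using ex by (rule LeastI)
  have least: "\<not> derived_series j \<subseteq> Z" if "j < k" for j
    using that not_less_Least unfolding k_def by blast
  consider "k = 0" | "k = Suc 0" | j where "k = Suc (Suc j)"
    by (metis not0_implies_Suc)
  then show ?thesis
  proof cases
    case 1
    then show ?thesis using k by (auto simp: Z_def)
  next
    case 2
    then show ?thesis using k by (simp add: Z_def)
  next
    case 3
    define R where "R = derived_series j"
    define S where "S = lie_product R R"
    have R: "lie_ideal R" unfolding R_def by (rule lie_ideal_derived_series)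
    have S: "lie_ideal S" unfolding S_def using R by (intro lie_ideal_lie_product)
    have SS: "bracket s t \<in> Z" if "s \<in> S" "t \<in> S" for s t
      using k lie_product_I[OF that] unfolding 3 S_def R_def by auto
    have LS_S: "lie_product UNIV S \<subseteq> S"
      using S by (intro lie_product_minimal lie_ideal_subspace lie_ideal_bracket_right)
    have LS: "lie_product UNIV S \<subseteq> Z"
      unfolding Z_def
    proof (rule lie_product_centralizes_char0[OF char chief lie_ideal_UNIV S])
      show "bracket (bracket x y) y \<in> factor_centralizer W' W" if "y \<in> S" for x y
        using SS[OF lie_ideal_bracket_right[OF S that] that] by (simp add: Z_def)
      show "bracket s t \<in> factor_centralizer W' W"
        if "s \<in> lie_product UNIV S" "t \<in> lie_product UNIV S" for s t
        using SS[of s t] that LS_S by (auto simp: Z_def)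
    qed
    have "S \<subseteq> Z"
      unfolding Z_def S_def
    proof (rule lie_product_centralizes_char0[OF char chief R R])
      show "bracket (bracket x y) y \<in> factor_centralizer W' W" if "x \<in> R" "y \<in> R" for x y
      proof -
        have "bracket x y \<in> S" unfolding S_def using that by (rule lie_product_I)
        then have "bracket y (bracket x y) \<in> Z" using LS lie_product_I[of y UNIV _ S] by blast
        then show ?thesis
          using bracket_skew[of "bracket x y" y] subspace_neg[OF sZ] by (simp add: Z_def)
      qed
      show "bracket s t \<in> factor_centralizer W' W"
        if "s \<in> lie_product R R" "t \<in> lie_product R R" for s t
        using SS that by (simp add: S_def Z_def)
    qed
    then show ?thesis using least[of "Suc j"] 3 by (simp add: S_def R_def)
  qed
qed

text \<open>Each application of \<open>ad x\<close> moves an ideal one step down a chief series.\<close>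

lemma ad_nilpotent_if_centralizes_chief_factors:
  assumes "\<And>W' W. chief_factor W' W \<Longrightarrow> x \<in> factor_centralizer W' W"
  shows "\<exists>n. \<forall>y. (ad x ^^ n) y = 0"
proof -
  have "\<exists>n. \<forall>y\<in>W. (ad x ^^ n) y = 0" if "lie_ideal W" for W
    using that
  proof (induction "dim W" arbitrary: W rule: less_induct)
    case less
    show ?case
    proof (cases "W = {0}")
      case True
      then show ?thesis by (intro exI[of _ 0]) simp
    next
      case False
      then obtain W' where chief: "chief_factor W' W"
        using less.prems chief_factor_below by blast
      note D = chief_factorD[OF chief]
      obtain n where n: "\<forall>y\<in>W'. (ad x ^^ n) y = 0"
        using less.hyps[OF psubspace_dim_less[OF D(4,5,3)] D(1)] by blast
      have "(ad x ^^ Suc n) y = 0" if "y \<in> W" for y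
      proof -
        have "bracket x y \<in> W'" using assms[OF chief] that by (rule factor_centralizerD)
        then have "ad x y \<in> W'"
          using bracket_skew[of y x] subspace_neg[OF D(4)] by (simp add: ad_def)
        then show ?thesis using n by (simp add: funpow_swap1)
      qed
      then show ?thesis by blast
    qed
  qed
  then show ?thesis using lie_ideal_UNIV by blast
qed

end

section \<open>Conjugacy of complements\<close>

context lie_algebra
begin

lemma subalgebraD:
  assumes "subalgebra U"
  shows "subspace U" "\<And>x y. x \<in> U \<Longrightarrow> y \<in> U \<Longrightarrow> bracket x y \<in> U"
  using assms by (auto simp: subalgebra_def)

lemma maximal_subalgebraD:
  assumes "maximal_subalgebra H"
  shows "subalgebra H" "subspace H" "H \<noteq> UNIV"
  using assms by (auto simp: maximal_subalgebra_def subalgebra_def)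

lemma conjugate_refl: "conjugate U U"
proof -
  have "(\<lambda>x\<in>UNIV. x) \<in> inner_automorphisms"
    unfolding inner_automorphisms_def using generate.one[of "BijGroup UNIV" inner_generators]
    by (simp add: BijGroup_def)
  moreover have "U = (\<lambda>x\<in>UNIV. x) ` U" by simp
  ultimately show ?thesis unfolding conjugate_def by blast
qed

text \<open>Otherwise \<open>A = [A, A] + C\<close> lies in \<open>L\<^sup>2 + C\<close>, which centralises \<open>A / C\<close>.\<close>

lemma abelian_chief_factor:
  assumes chief: "chief_factor C A" and cent: "derived_algebra \<subseteq> factor_centralizer C A"
    and u: "u \<in> A" and v: "v \<in> A"
  shows "bracket u v \<in> C"
proof (rule ccontr)
  note D = chief_factorD[OF chief]
  assume "bracket u v \<notin> C"
  then have not: "\<not> lie_product A A \<subseteq> C" using lie_product_I[OF u v] by blast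
  have AA: "lie_product A A \<subseteq> A"
    using D(2) by (rule lie_product_subset_ideal)
  obtain j c where jc: "j \<in> lie_product A A" "c \<in> C" "u = j + c"
    by (rule chief_factor_sum[OF chief lie_ideal_lie_product[OF D(2,2)] AA not u])
  have "lie_product A A \<subseteq> derived_algebra"
    unfolding lie_product_def by (rule span_mono) blast
  then have "j \<in> factor_centralizer C A" using jc(1) cent by (meson subsetD)
  then have "bracket j v \<in> C" using v by (rule factor_centralizerD)
  moreover have "bracket c v \<in> C" using jc(2) D(1) by (intro lie_ideal_bracket_left)
  ultimately have "bracket u v \<in> C"
    unfolding jc(3) bracket_add_left by (rule subspace_add[OF D(4)])
  then show False using \<open>bracket u v \<notin> C\<close> by blast
qed

text \<open>The subalgebra \<open>H + A\<close> properly contains \<open>H\<close>, as an ideal inside \<open>H\<close> would lie in the core.\<close>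

lemma maximal_subalgebra_sum_chief_factor:
  assumes H: "maximal_subalgebra H" and chief: "chief_factor (core H) A"
  obtains h a where "h \<in> H" "a \<in> A" "x = h + a"
proof -
  note D = chief_factorD[OF chief] and H' = maximal_subalgebraD[OF H]
  define S where "S = {h + a | h a. h \<in> H \<and> a \<in> A}"
  have "subalgebra S"
    unfolding subalgebra_def
  proof (intro conjI ballI)
    show "subspace S" unfolding S_def using H'(2) D(5) by (rule subspace_sums)
    fix x y assume "x \<in> S" "y \<in> S"
    then obtain h a h' a' where xy: "h \<in> H" "a \<in> A" "x = h + a" "h' \<in> H" "a' \<in> A" "y = h' + a'"
      unfolding S_def by blast
    have "bracket x y = bracket h h' + (bracket h a' + bracket a y)"
      by (simp add: xy(3,6) bracket_add_left bracket_add_right algebra_simps)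
    moreover have "bracket h h' \<in> H" using xy subalgebraD[OF H'(1)] by blast
    moreover have "bracket h a' + bracket a y \<in> A"
      using xy D(2) by (intro subspace_add[OF D(5)] lie_ideal_bracket_left lie_ideal_bracket_right)
    ultimately show "bracket x y \<in> S" unfolding S_def by blast
  qed
  moreover have HS: "H \<subseteq> S" unfolding S_def using subspace_0[OF D(5)] by force
  moreover have AS: "A \<subseteq> S" unfolding S_def using subspace_0[OF H'(2)] by force
  moreover have "\<not> A \<subseteq> H" using core_greatest[OF H'(2) D(2)] D(3) by blast
  ultimately have "S = UNIV"
    using H unfolding maximal_subalgebra_def by blast
  then show thesis using that unfolding S_def by blast
qed

text \<open>\<open>H \<inter> A\<close> is normalised by \<open>H\<close>, and by \<open>A\<close> because \<open>A\<close> is abelian modulo the core of \<open>H\<close>; so it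
  is an ideal of \<open>L = H + A\<close>.\<close>

lemma maximal_subalgebra_inter_chief_factor:
  assumes H: "maximal_subalgebra H" and chief: "chief_factor (core H) A"
    and abel: "\<And>u v. u \<in> A \<Longrightarrow> v \<in> A \<Longrightarrow> bracket u v \<in> core H"
    and z: "z \<in> H" "z \<in> A"
  shows "z \<in> core H"
proof -
  note D = chief_factorD[OF chief] and H' = maximal_subalgebraD[OF H]
  have "lie_ideal (H \<inter> A)"
    unfolding lie_ideal_def
  proof (intro conjI ballI allI)
    show "subspace (H \<inter> A)" using H'(2) D(5) by (rule subspace_inter)
    fix x y assume x: "x \<in> H \<inter> A"
    obtain h a where y: "h \<in> H" "a \<in> A" "y = h + a"
      using maximal_subalgebra_sum_chief_factor[OF H chief] by metis
    have "bracket x a \<in> H" using x y abel core_subset[OF H'(2)] by blast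
    then have "bracket x y \<in> H"
      using x y subalgebraD[OF H'(1)] by (auto simp: bracket_add_right intro: subspace_add)
    then show "bracket x y \<in> H \<inter> A" using x D lie_ideal_bracket_left by blast
  qed
  then have "H \<inter> A \<subseteq> core H" using H'(2) by (intro core_greatest) auto
  then show ?thesis using z by blast
qed

lemma exp_ad_mod_chief_factor:
  assumes chief: "chief_factor C A" and abel: "\<And>u v. u \<in> A \<Longrightarrow> v \<in> A \<Longrightarrow> bracket u v \<in> C"
    and x: "x \<in> A" and n: "n \<ge> 2"
  shows "exp_ad n x y - (y + bracket y x) \<in> C"
proof -
  note D = chief_factorD[OF chief]
  have pow: "(ad x ^^ Suc (Suc r)) y \<in> C" for r
  proof (induction r)
    case 0
    show ?case using x D abel by (simp add: ad_def lie_ideal_bracket_right)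
  next
    case (Suc r)
    then have "bracket ((ad x ^^ Suc (Suc r)) y) x \<in> C" using D by (intro lie_ideal_bracket_left)
    then show ?case by (simp only: funpow.simps(2)[of "Suc (Suc r)"] comp_apply
        ad_def[of x "(ad x ^^ Suc (Suc r)) y"])
  qed
  have rest: "scale (1 / of_nat (fact r)) ((ad x ^^ r) y) \<in> C" if r: "r \<in> {2..<n}" for r
  proof -
    obtain s where "r = Suc (Suc s)" using r by (metis atLeastLessThan_iff add_2_eq_Suc le_Suc_ex)
    then show ?thesis using pow subspace_scale[OF D(4)] by blast
  qed
  have "{..<n} = insert 0 (insert 1 {2..<n})" using n by auto
  then have "exp_ad n x y - (y + bracket y x)
      = (\<Sum>r=2..<n. scale (1 / of_nat (fact r)) ((ad x ^^ r) y))"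
    by (simp add: exp_ad_def ad_def)
  then show ?thesis by (simp only:) (rule subspace_sum[OF D(4) rest])
qed

text \<open>The centraliser in \<open>M\<close> is an ideal of \<open>L = M + A\<close>, because bracketing it with \<open>A\<close> leads into
  the core, which is contained in \<open>M\<close>.\<close>

lemma centralizer_in_maximal_subalgebra:
  assumes M: "maximal_subalgebra M" and chief: "chief_factor (core M) A"
    and abel: "\<And>u v. u \<in> A \<Longrightarrow> v \<in> A \<Longrightarrow> bracket u v \<in> core M"
  shows "M \<inter> factor_centralizer (core M) A \<subseteq> core M"
proof -
  note D = chief_factorD[OF chief] and M' = maximal_subalgebraD[OF M]
  define Z where "Z = M \<inter> factor_centralizer (core M) A"
  have F: "lie_ideal (factor_centralizer (core M) A)" using D by (intro lie_ideal_factor_centralizer)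
  have "lie_ideal Z"
    unfolding lie_ideal_def
  proof (intro conjI ballI allI)
    show "subspace Z" unfolding Z_def by (intro subspace_inter M'(2) lie_ideal_subspace[OF F])
    fix z y assume z: "z \<in> Z"
    obtain m a where y: "m \<in> M" "a \<in> A" "y = m + a"
      using maximal_subalgebra_sum_chief_factor[OF M chief] by metis
    have "bracket z a \<in> core M" using z y by (auto simp: Z_def dest: factor_centralizerD)
    then have "bracket z a \<in> M" using core_subset[OF M'(2)] by blast
    moreover have "bracket z m \<in> M" using z y subalgebraD[OF M'(1)] by (auto simp: Z_def)
    ultimately have "bracket z y \<in> M"
      using subspace_add[OF M'(2)] by (simp add: y(3) bracket_add_right)
    moreover have "bracket z y \<in> factor_centralizer (core M) A"
      using z F by (auto simp: Z_def intro: lie_ideal_bracket_left)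
    ultimately show "bracket z y \<in> Z" by (simp add: Z_def)
  qed
  then have "Z \<subseteq> core M" using M'(2) by (intro core_greatest) (auto simp: Z_def)
  then show ?thesis by (simp add: Z_def)
qed

text \<open>Schur's lemma: \<open>M\<close> is abelian modulo the core, so the action of \<open>b\<close> on \<open>A\<close> modulo the core
  commutes with that of \<open>L = M + A\<close>. Its kernel and image are therefore ideals of \<open>L\<close>, and the action
  is nonzero as \<open>b\<close> does not centralise \<open>A\<close>.\<close>

lemma bracket_invertible_on_chief_factor:
  assumes M: "maximal_subalgebra M" and chief: "chief_factor (core M) A"
    and cent: "derived_algebra \<subseteq> factor_centralizer (core M) A"
    and b: "b \<in> M" "b \<notin> core M"
  shows "\<And>a. a \<in> A \<Longrightarrow> bracket b a \<in> core M \<Longrightarrow> a \<in> core M"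
    and "\<And>d. d \<in> A \<Longrightarrow> \<exists>a\<in>A. \<exists>c\<in>core M. d = bracket b a + c"
proof -
  note D = chief_factorD[OF chief] and M' = maximal_subalgebraD[OF M]
  define C where "C = core M"
  note abel = abelian_chief_factor[OF chief cent, folded C_def]
  note [intro] = lie_ideal_bracket_left lie_ideal_bracket_right
  note CA = D[folded C_def] and addC = subspace_add[OF D(4), folded C_def]
  have centC: "M \<inter> factor_centralizer C A \<subseteq> C"
    unfolding C_def
    by (rule centralizer_in_maximal_subalgebra[OF M chief abelian_chief_factor[OF chief cent]])
  have MM: "bracket b m \<in> C" if "m \<in> M" for m
    using centC cent lie_product_I[of b UNIV m UNIV] subalgebraD(2)[OF M'(1) b(1) that]
    by (auto simp: C_def)
  have comm: "bracket (bracket b y) a \<in> C" if a: "a \<in> A" for a y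
  proof -
    obtain m a' where y: "m \<in> M" "a' \<in> A" "y = m + a'"
      using maximal_subalgebra_sum_chief_factor[OF M chief] by metis
    have "bracket (bracket b m) a \<in> C" using MM[OF y(1)] CA by blast
    moreover have "bracket (bracket b a') a \<in> C" using abel a y CA by blast
    ultimately show ?thesis by (simp add: y(3) bracket_add_left bracket_add_right addC)
  qed
  obtain a\<^sub>1 where a\<^sub>1: "a\<^sub>1 \<in> A" "bracket b a\<^sub>1 \<notin> C"
    using centC b by (auto simp: factor_centralizer_def C_def)
  define N where "N = {a \<in> A. bracket b a \<in> C}"
  have "lie_ideal N"
    unfolding lie_ideal_def
  proof (intro conjI ballI allI)
    show "subspace N"
      unfolding N_def subspace_def
      by (auto simp: bracket_add_right bracket_scale_right
          intro: subspace_0[OF CA(4)] subspace_add[OF CA(4)] subspace_scale[OF CA(4)]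
          subspace_0[OF CA(5)] subspace_add[OF CA(5)] subspace_scale[OF CA(5)])
    fix a y assume a: "a \<in> N"
    have "bracket b (bracket a y) = bracket (bracket b a) y - bracket (bracket b y) a"
      using bracket_derivation[of b a y] by simp
    moreover have "bracket (bracket b a) y \<in> C" "bracket (bracket b y) a \<in> C"
      using a comm CA by (auto simp: N_def)
    ultimately show "bracket a y \<in> N"
      using a CA subspace_diff[OF CA(4)] by (auto simp: N_def)
  qed
  moreover have "C \<subseteq> N" "N \<subseteq> A" unfolding N_def using CA by auto
  ultimately have "N = C"
    using chief_factor_between[OF chief, of N] a\<^sub>1 unfolding C_def N_def by blast
  then show "a \<in> core M" if "a \<in> A" "bracket b a \<in> core M" for a
    using that unfolding N_def C_def by blast
  define R where "R = {x + c | x c. x \<in> bracket b ` A \<and> c \<in> C}"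
  have "lie_ideal R"
    unfolding lie_ideal_def
  proof (intro conjI ballI allI)
    show "subspace R"
      unfolding R_def using subspace_bracket_image[OF CA(5)] CA(4) by (rule subspace_sums)
    fix r y assume "r \<in> R"
    then obtain a c where r: "a \<in> A" "c \<in> C" "r = bracket b a + c" unfolding R_def by blast
    have "bracket r y = bracket b (bracket a y) + (bracket (bracket b y) a + bracket c y)"
      using bracket_derivation[of b a y] by (simp add: r(3) bracket_add_left)
    moreover have "bracket a y \<in> A" using r CA by blast
    moreover have "bracket (bracket b y) a + bracket c y \<in> C"
      using comm r CA by (intro addC) auto
    ultimately show "bracket r y \<in> R" unfolding R_def by blast
  qed
  moreover have "C \<subseteq> R"
  proof
    fix c assume "c \<in> C"
    moreover have "c = bracket b 0 + c" by simp
    ultimately show "c \<in> R" unfolding R_def using subspace_0[OF CA(5)] by blast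
  qed
  moreover have "R \<subseteq> A"
    unfolding R_def using CA by (auto intro!: subspace_add[OF CA(5)])
  moreover have "bracket b a\<^sub>1 \<in> R"
  proof -
    have "bracket b a\<^sub>1 = bracket b a\<^sub>1 + 0" by simp
    then show ?thesis unfolding R_def using a\<^sub>1 subspace_0[OF CA(4)] by blast
  qed
  ultimately have "R = A"
    using chief_factor_between[OF chief, of R] a\<^sub>1 unfolding C_def by blast
  then show "\<exists>a\<in>A. \<exists>c\<in>core M. d = bracket b a + c" if "d \<in> A" for d
    using that unfolding R_def C_def by blast
qed

end

context fin_dim_lie_algebra
begin

text \<open>It is enough to move a single element \<open>b\<close> of \<open>M\<close> outside the core into \<open>K\<close>: modulo the core,
  \<open>K\<close> contains every element that commutes with the image of \<open>b\<close>.\<close>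

lemma conjugate_if_core_eq:
  assumes M: "maximal_subalgebra M" and K: "maximal_subalgebra K" and core: "core M = core K"
    and cent: "\<And>W' W. chief_factor W' W \<Longrightarrow> derived_algebra \<subseteq> factor_centralizer W' W"
    and gen: "\<And>x. x \<in> derived_algebra \<Longrightarrow>
      \<exists>n\<ge>2. exp_ad n x \<in> inner_generators"
  shows "conjugate K M"
proof (cases "M = core M")
  case True
  note M' = maximal_subalgebraD[OF M] and K' = maximal_subalgebraD[OF K]
  have "M \<subseteq> K" using True core core_subset[OF K'(2)] by simp
  then have "K = M" using M K' unfolding maximal_subalgebra_def by blast
  then show ?thesis by (simp add: conjugate_refl)
next
  case False
  note M' = maximal_subalgebraD[OF M] and K' = maximal_subalgebraD[OF K]
  define C where "C = core M"
  have CM: "C \<subseteq> M" and CK: "C \<subseteq> K"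
    using core_subset[OF M'(2)] core_subset[OF K'(2)] core by (simp_all add: C_def)
  obtain b where b: "b \<in> M" "b \<notin> C" using False CM C_def by blast
  obtain A where chief: "chief_factor C A"
    using chief_factor_above[of C] lie_ideal_core[OF M'(2)] CM M'(3) unfolding C_def by blast
  note D = chief_factorD[OF chief]
  have chiefM: "chief_factor (core M) A" and chiefK: "chief_factor (core K) A"
    using chief core by (simp_all add: C_def)
  note abel = abelian_chief_factor[OF chief cent[OF chief]]
  note invertible = bracket_invertible_on_chief_factor[OF M chiefM cent[OF chiefM] b(1) b(2)[unfolded C_def],
      folded C_def]
  have KA: "z \<in> C" if "z \<in> K" "z \<in> A" for z
    using maximal_subalgebra_inter_chief_factor[OF K chiefK _ that] abel core by (simp add: C_def)
  obtain k d where kd: "k \<in> K" "d \<in> A" "b = k + d"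
    using maximal_subalgebra_sum_chief_factor[OF K chiefK] by metis
  \<comment> \<open>The conjugating element is found in \<open>[b, A]\<close>, hence in \<open>L\<^sup>2\<close>: apply surjectivity twice.\<close>
  obtain a c where ac: "a \<in> A" "c \<in> C" "d = bracket b a + c" using invertible(2)[OF kd(2)] by blast
  obtain a' c' where ac': "a' \<in> A" "c' \<in> C" "a = bracket b a' + c'" using invertible(2)[OF ac(1)] by blast
  define x where "x = bracket b (- a')"
  have xD: "x \<in> derived_algebra" unfolding x_def by (intro lie_product_I UNIV_I)
  have xA: "x \<in> A"
    unfolding x_def using ac' D by (intro lie_ideal_bracket_right subspace_neg)
  have "d + bracket b x = c + bracket b c'"
    by (simp add: ac(3) ac'(3) x_def bracket_minus_right bracket_add_right)
  then have dx: "d + bracket b x \<in> C"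
    using subspace_add[OF D(4) ac(2) lie_ideal_bracket_right[OF D(1) ac'(2)]] by simp
  obtain n where n: "n \<ge> 2" "exp_ad n x \<in> inner_generators"
    using gen[OF xD] by blast
  define \<alpha> where "\<alpha> = exp_ad n x"
  have \<alpha>_inner: "\<alpha> \<in> inner_automorphisms"
    unfolding inner_automorphisms_def \<alpha>_def by (rule generate.incl[OF n(2)])
  have \<alpha>_mod: "\<alpha> y - (y + bracket y x) \<in> C" for y
    unfolding \<alpha>_def by (rule exp_ad_mod_chief_factor[OF chief abel xA n(1)])
  have MM: "bracket b m \<in> C" if "m \<in> M" for m
  proof -
    have "bracket b m \<in> factor_centralizer (core M) A"
      using cent[OF chiefM] lie_product_I[of b UNIV m UNIV] by blast
    then show ?thesis
      using centralizer_in_maximal_subalgebra[OF M chiefM] abel subalgebraD(2)[OF M'(1) b(1) that]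
      by (auto simp: C_def)
  qed
  \<comment> \<open>\<open>\<alpha> b\<close> equals \<open>k\<close> modulo the core, and \<open>\<alpha> m\<close> commutes with it; so its component in \<open>A\<close> along
    \<open>K\<close> is killed by \<open>k\<close>, hence by \<open>b\<close>.\<close>
  have \<alpha>M: "\<alpha> m \<in> K" if m: "m \<in> M" for m
  proof -
    obtain k' d' where kd': "k' \<in> K" "d' \<in> A" "\<alpha> m = k' + d'"
      using maximal_subalgebra_sum_chief_factor[OF K chiefK] by metis
    define e where "e = \<alpha> m - (m + bracket m x)"
    have e: "e \<in> C" unfolding e_def by (rule \<alpha>_mod)
    define f where "f = d + bracket b x"
    have k: "k = (b + bracket b x) - f" by (simp add: f_def kd(3))
    have \<alpha>m: "\<alpha> m = (m + bracket m x) + e" by (simp add: e_def)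
    have "bracket k (\<alpha> m) = bracket (b + bracket b x) (m + bracket m x)
        + (bracket k e - bracket f (m + bracket m x))"
      unfolding \<alpha>m bracket_add_right[of k "m + bracket m x"]
      by (subst (1) k) (simp add: bracket_diff_left)
    also have "bracket (b + bracket b x) (m + bracket m x)
        = bracket b m + (bracket (bracket b m) x + bracket (bracket b x) (bracket m x))"
      by (simp add: bracket_derivation[of b m x] bracket_add_left bracket_add_right algebra_simps)
    also have "\<dots> + (bracket k e - bracket f (m + bracket m x)) \<in> C"
      by (intro subspace_add[OF D(4)] subspace_diff[OF D(4)] lie_ideal_bracket_left[OF D(1) MM[OF m]]
          lie_ideal_bracket_left[OF D(1) dx[folded f_def]] lie_ideal_bracket_right[OF D(1) e]
          abel[OF lie_ideal_bracket_right[OF D(2) xA] lie_ideal_bracket_right[OF D(2) xA]] MM[OF m])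
    finally have "bracket k (\<alpha> m) \<in> K" using CK by blast
    then have "bracket k d' \<in> K"
      using subspace_diff[OF K'(2) _ subalgebraD(2)[OF K'(1) kd(1) kd'(1)], of "bracket k (\<alpha> m)"]
      by (simp add: kd'(3) bracket_add_right)
    then have "bracket k d' \<in> C" by (rule KA) (rule lie_ideal_bracket_right[OF D(2) kd'(2)])
    then have "bracket b d' \<in> C"
      using abel[OF kd(2) kd'(2)] by (simp add: kd(3) bracket_add_left subspace_add[OF D(4)])
    then have "d' \<in> C" using invertible(1)[OF kd'(2)] by blast
    then show ?thesis using kd' CK subspace_add[OF K'(2)] by auto
  qed
  have "K = \<alpha> ` M"
  proof
    show "\<alpha> ` M \<subseteq> K" using \<alpha>M by blast
    show "K \<subseteq> \<alpha> ` M"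
    proof
      fix z assume z: "z \<in> K"
      obtain m a where ma: "m \<in> M" "a \<in> A" "z = m + a"
        using maximal_subalgebra_sum_chief_factor[OF M chiefM] by metis
      have "z - \<alpha> m = a - ((\<alpha> m - (m + bracket m x)) + bracket m x)" by (simp add: ma(3))
      moreover have "(\<alpha> m - (m + bracket m x)) + bracket m x \<in> A"
        using \<alpha>_mod[of m] xA D by (intro subspace_add[OF D(5)] lie_ideal_bracket_right[OF D(2)]) auto
      ultimately have "z - \<alpha> m \<in> A" using subspace_diff[OF D(5) ma(2)] by (simp only:)
      moreover have "z - \<alpha> m \<in> K" using z \<alpha>M[OF ma(1)] by (rule subspace_diff[OF K'(2)])
      ultimately have "z - \<alpha> m \<in> \<alpha> ` C"
        using KA inner_automorphism_preserves_ideals[OF \<alpha>_inner] D(1) by simp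
      then obtain c where c: "c \<in> C" "z - \<alpha> m = \<alpha> c" by blast
      then have "z = \<alpha> (c + m)" by (simp add: \<alpha>_def exp_ad_add diff_eq_eq)
      moreover have "c + m \<in> M" using c CM ma subspace_add[OF M'(2)] by blast
      ultimately show "z \<in> \<alpha> ` M" by blast
    qed
  qed
  with \<alpha>_inner show ?thesis unfolding conjugate_def by blast
qed

lemma conjugate_iff_core_eq:
  assumes solv: "solvable"
    and nil: "CHAR('f) > 0 \<Longrightarrow>
      nilpotent derived_algebra \<and> nilpotency_class derived_algebra < CHAR('f)"
    and M: "maximal_subalgebra M" and K: "maximal_subalgebra K"
  shows "conjugate M K \<longleftrightarrow> core M = core K"
proof
  assume "conjugate M K"
  then show "core M = core K" using M K maximal_subalgebraD(2) core_eq_if_conjugate by blast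
next
  assume core: "core M = core K"
  have cent: "derived_algebra \<subseteq> factor_centralizer W' W" if "chief_factor W' W" for W' W
    using derived_algebra_centralizes_char0[OF _ solv that]
      derived_algebra_centralizes_if_nilpotent[OF _ that] nil by blast
  have gen: "\<exists>n\<ge>2. exp_ad n x \<in> inner_generators"
    if x: "x \<in> derived_algebra" for x
  proof (cases "CHAR('f) = 0")
    case True
    obtain n where "\<forall>y. (ad x ^^ n) y = 0"
      using ad_nilpotent_if_centralizes_chief_factors cent x by blast
    \<comment> \<open>Two more terms, all zero, make sure that the terms of degree 0 and 1 are present.\<close>
    then have "\<forall>y. (ad x ^^ (n + 2)) y = 0" by (simp only: funpow_add comp_apply) blast
    moreover from this have "exp_ad (n + 2) x \<in> inner_generators"
      unfolding inner_generators_def using True by blast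
    ultimately show ?thesis by (metis le_add2)
  next
    case False
    then have "CHAR('f) \<ge> 2" using CHAR_not_1[where 'a = 'f] by linarith
    moreover have "exp_ad CHAR('f) x \<in> inner_generators"
      unfolding inner_generators_def using False nil lie_ideal_derived_algebra x by blast
    ultimately show ?thesis by blast
  qed
  show "conjugate M K" by (rule conjugate_if_core_eq[OF K M core[symmetric] cent gen])
qed

end

theorem theorem0p4:
  fixes scale :: "'f::field \<Rightarrow> 'a::ab_group_add \<Rightarrow> 'a"
    and bracket :: "'a \<Rightarrow> 'a \<Rightarrow> 'a"
    and Basis M K :: "'a set"
  assumes "lie_algebra scale bracket"
    and "finite_dimensional_vector_space scale Basis"
    and "lie_algebra.solvable scale bracket"
    and "CHAR('f) > 0 \<Longrightarrow>
           lie_algebra.nilpotent scale bracket (lie_algebra.lie_product scale bracket UNIV UNIV) \<and>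
           lie_algebra.nilpotency_class scale bracket
             (lie_algebra.lie_product scale bracket UNIV UNIV) < CHAR('f)"
    and "lie_algebra.maximal_subalgebra scale bracket M"
    and "lie_algebra.maximal_subalgebra scale bracket K"
  shows "lie_algebra.conjugate scale bracket M K \<longleftrightarrow>
         lie_algebra.core scale bracket M = lie_algebra.core scale bracket K"
proof -
  interpret fin_dim_lie_algebra scale bracket Basis
    using assms(1,2) by (rule fin_dim_lie_algebra.intro)
  show ?thesis using assms(3-6) by (rule conjugate_iff_core_eq)
qed

end
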